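(* Let $\kappa$ be an infinite cardinal. If $X\in\mathcal C_\kappa$, then $\mu(X)\le\kappa$.
   Context: Spaces are non-empty, and cardinal invariants take infinite values. For a space $X$ let $\mathcal T$ be the family of all non-empty open subsets of $X$ and, for an ordinal $\alpha$, let $\mathcal T^\alpha$ be the set of all sequences of length $\alpha$ of elements of $\mathcal T$. For an infinite cardinal $\kappa$, the space $X$ is called $\kappa$-favorable if there is a function $s:\bigcup\{\mathcal T^\alpha:\alpha<\kappa\}\to\mathcal T$ such that for every sequence $\{B_{\alpha+1}:\alpha<\kappa\}\subseteq\mathcal T$ with $B_1\subseteq s(\emptyset)$ and $B_{\alpha+1}\subseteq s(\{B_{\gamma+1}:\gamma<\alpha\})$ for each $\alpha<\kappa$, the union $\bigcup\{B_{\alpha+1}:\alpha<\kappa\}$ is dense in $X$. $\mu(X)$ is the least infinite cardinal $\kappa$ such that $X$ is $\kappa$-favorable. A continuous surjection $f:X\to Y$ is skeletal if for every non-empty open $U\subseteq X$ the closure of $f[U]$ has non-empty interior. A directed set $\Sigma$ is $\kappa$-complete if every chain of length $\le\kappa$ consisting of elements of $\Sigma$ has a least upper bound in $\Sigma$. An inverse system $\{X_\sigma,\pi^\sigma_\varrho,\Sigma\}$ is $\kappa$-complete if $\Sigma$ is $\kappa$-complete and for every chain $A\subseteq\Sigma$ with $|A|\le\kappa$ and $\sigma=\sup A\in\Sigma$ we have $X_\sigma=\varprojlim\{X_\alpha,\pi^\beta_\alpha,A\}$. All bonding maps are assumed to be (continuous) surjections. $\mathcal C_\kappa$ is the class of all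 spaces that are (homeomorphic to) inverse limits of $\kappa$-complete inverse systems $\{X_\sigma,\pi^\sigma_\varrho,\Sigma\}$ in which every $X_\sigma$ is a $T_0$-space of weight $\operatorname{w}(X_\sigma)\le\kappa$ and all bonding maps $\pi^\sigma_\varrho$ are skeletal.
   Formalization: The limit projections from X to each X_σ are also required to be onto, not only the bonding maps; without this the claim fails for κ=ω, e.g. the one-point compactification of a discrete space of size ω_2 arises as such a limit but is not ω-favorable. *)

theory Defs
  imports "HOL-Analysis.Analysis"
begin

unbundle cardinal_syntax

text \<open>
  Cardinals are the cardinal orders of the HOL library: relations \<open>r\<close> with \<open>Card_order r\<close>,
  compared across types by \<open>\<le>o\<close>.  The ordinals below a cardinal \<open>r\<close> are represented by the
  elements of \<open>Field r\<close>, and the set of ordinals below such an \<open>\<alpha>\<close> is \<open>underS r \<alpha>\<close>.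

  The operator below picks the least infinite cardinal with property \<open>P\<close> among the cardinals that
  live on the type \<open>'c\<close>.  For a property that does not depend on the representation of cardinals
  this is the least such cardinal outright as soon as some cardinal on \<open>'c\<close> satisfies \<open>P\<close>, because
  every smaller cardinal is then also represented on \<open>'c\<close>.  The two invariants below use the type
  \<open>nat + 'a set\<close>, which is large enough by the lemmas \<open>weight_is_least\<close> and \<open>mu_is_least\<close>.
\<close>

definition least_infinite_card :: "('c rel \<Rightarrow> bool) \<Rightarrow> 'c rel" where
  "least_infinite_card P =
     (SOME r. Cinfinite r \<and> P r \<and> (\<forall>r'. Cinfinite r' \<and> P r' \<longrightarrow> r \<le>o r'))"

lemma least_infinite_card:
  assumes "Cinfinite r" "P r"
  shows "Cinfinite (least_infinite_card P)" "P (least_infinite_card P)"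
    "\<And>r'. Cinfinite r' \<Longrightarrow> P r' \<Longrightarrow> least_infinite_card P \<le>o r'"
proof -
  let ?Q = "{r. Cinfinite r \<and> P r}"
  have "?Q \<noteq> {}" "\<forall>r\<in>?Q. Card_order r" using assms by auto
  then have "\<exists>r\<in>?Q. \<forall>r'\<in>?Q. r \<le>o r'" by (rule exists_minim_Card_order)
  then have "\<exists>r. Cinfinite r \<and> P r \<and> (\<forall>r'. Cinfinite r' \<and> P r' \<longrightarrow> r \<le>o r')" by blast
  from someI_ex[OF this] show "Cinfinite (least_infinite_card P)" "P (least_infinite_card P)"
    "\<And>r'. Cinfinite r' \<Longrightarrow> P r' \<Longrightarrow> least_infinite_card P \<le>o r'"
    unfolding least_infinite_card_def by auto
qed

lemma Cinfinite_nat_plus_set: "Cinfinite |UNIV :: (nat + 'a set) set|"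
  by (simp add: cinfinite_def Field_card_of finite_Plus_UNIV_iff card_of_card_order_on)

definition is_base :: "'a topology \<Rightarrow> 'a set set \<Rightarrow> bool" where
  "is_base X \<B> \<longleftrightarrow>
     (\<forall>V\<in>\<B>. openin X V) \<and>
     (\<forall>U x. openin X U \<and> x \<in> U \<longrightarrow> (\<exists>V\<in>\<B>. x \<in> V \<and> V \<subseteq> U))"

text \<open>As all cardinal invariants, the weight is infinite by convention.\<close>

definition weight :: "'a topology \<Rightarrow> (nat + 'a set) rel" where
  "weight X = least_infinite_card (\<lambda>r. \<exists>\<B>. is_base X \<B> \<and> |\<B>| \<le>o r)"

lemma weight_is_least:
  fixes X :: "'a topology"
  shows
  "Cinfinite (weight X)" "\<exists>\<B>. is_base X \<B> \<and> |\<B>| \<le>o weight X"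
  "\<And>r :: (nat + 'a set) rel. Cinfinite r \<Longrightarrow> \<exists>\<B>. is_base X \<B> \<and> |\<B>| \<le>o r \<Longrightarrow> weight X \<le>o r"
proof -
  have "is_base X {U. openin X U}" by (auto simp: is_base_def)
  moreover have "|{U. openin X U}| \<le>o |UNIV :: (nat + 'a set) set|"
    by (rule card_of_ordLeqI[where f = Inr]) (auto simp: inj_on_def)
  ultimately have "\<exists>\<B>. is_base X \<B> \<and> |\<B>| \<le>o |UNIV :: (nat + 'a set) set|" by blast
  note L = least_infinite_card[where P = "\<lambda>r. \<exists>\<B>. is_base X \<B> \<and> |\<B>| \<le>o r",
      OF Cinfinite_nat_plus_set this, folded weight_def]
  show "Cinfinite (weight X)" "\<exists>\<B>. is_base X \<B> \<and> |\<B>| \<le>o weight X"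
    "\<And>r :: (nat + 'a set) rel. Cinfinite r \<Longrightarrow> \<exists>\<B>. is_base X \<B> \<and> |\<B>| \<le>o r \<Longrightarrow> weight X \<le>o r"
    using L by auto
qed

definition nonempty_opens :: "'a topology \<Rightarrow> 'a set set" where
  "nonempty_opens X = {U. openin X U \<and> U \<noteq> {}}"

text \<open>
  Sequences of length \<open>\<alpha>\<close> are partial functions with domain \<open>underS \<kappa> \<alpha>\<close>, so that a sequence
  determines its length.
\<close>

definition open_sequences :: "'k rel \<Rightarrow> 'a topology \<Rightarrow> 'k \<Rightarrow> ('k \<rightharpoonup> 'a set) set" where
  "open_sequences \<kappa> X \<alpha> = {f. dom f = underS \<kappa> \<alpha> \<and> ran f \<subseteq> nonempty_opens X}"

text \<open>
  The set \<open>B \<alpha>\<close> stands for \<open>B\<close> with index \<open>\<alpha> + 1\<close>; the condition on \<open>B\<^sub>1\<close> is the one for the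
  least element \<open>\<alpha>\<close> of \<open>Field \<kappa>\<close>, where the history is the empty map.
\<close>

definition favorable :: "'k rel \<Rightarrow> 'a topology \<Rightarrow> bool" where
  "favorable \<kappa> X \<longleftrightarrow>
     (\<exists>s \<in> (\<Union>\<alpha>\<in>Field \<kappa>. open_sequences \<kappa> X \<alpha>) \<rightarrow> nonempty_opens X.
        \<forall>B \<in> Field \<kappa> \<rightarrow> nonempty_opens X.
          (\<forall>\<alpha>\<in>Field \<kappa>. B \<alpha> \<subseteq> s ((Some \<circ> B) |` underS \<kappa> \<alpha>)) \<longrightarrow>
          X closure_of (\<Union>\<alpha>\<in>Field \<kappa>. B \<alpha>) = topspace X)"

definition mu :: "'a topology \<Rightarrow> (nat + 'a set) rel" where
  "mu X = least_infinite_card (\<lambda>r. favorable r X)"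

lemma favorable_nat_plus_set:
  fixes X :: "'a topology"
  assumes "topspace X \<noteq> {}"
  shows "favorable |UNIV :: (nat + 'a set) set| X"
proof -
  let ?r = "|UNIV :: (nat + 'a set) set|"
  have wo: "Well_order ?r" by (rule card_of_Well_order)
  have F: "Field ?r = UNIV" by (rule Field_card_of)
  have tot: "(a, b) \<in> ?r \<or> (b, a) \<in> ?r" if "a \<noteq> b" for a b
    using wo F that by (auto simp: order_on_defs total_on_def)
  have inj: "a = b" if "underS ?r a = underS ?r b" for a b
    using tot[of a b] that by (cases "a = b") (auto simp: underS_def)
  define idx where "idx f = (THE \<alpha>. underS ?r \<alpha> = dom f)" for f :: "(nat + 'a set) \<rightharpoonup> 'a set"
  define s where
    "s f = (case idx f of Inl n \<Rightarrow> topspace X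
              | Inr U \<Rightarrow> if U \<in> nonempty_opens X then U else topspace X)"
    for f :: "(nat + 'a set) \<rightharpoonup> 'a set"
  have T: "topspace X \<in> nonempty_opens X" using assms by (simp add: nonempty_opens_def)
  have "s \<in> (\<Union>\<alpha>\<in>Field ?r. open_sequences ?r X \<alpha>) \<rightarrow> nonempty_opens X"
    using T by (auto simp: s_def split: sum.split)
  moreover have "X closure_of (\<Union>\<alpha>\<in>Field ?r. B \<alpha>) = topspace X"
    if B: "B \<in> Field ?r \<rightarrow> nonempty_opens X"
      and Bs: "\<forall>\<alpha>\<in>Field ?r. B \<alpha> \<subseteq> s ((Some \<circ> B) |` underS ?r \<alpha>)" for B
  proof -
    have "U \<inter> (\<Union>\<alpha>\<in>Field ?r. B \<alpha>) \<noteq> {}" if U: "openin X U" "U \<noteq> {}" for U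
    proof -
      have "dom ((Some \<circ> B) |` underS ?r (Inr U)) = underS ?r (Inr U)"
        by (auto simp: restrict_map_def dom_def)
      then have "idx ((Some \<circ> B) |` underS ?r (Inr U)) = Inr U"
        unfolding idx_def using inj by (intro the_equality) auto
      then have "s ((Some \<circ> B) |` underS ?r (Inr U)) = U"
        using U by (simp add: s_def nonempty_opens_def)
      then have "B (Inr U) \<subseteq> U" using Bs F by (metis UNIV_I)
      moreover have "B (Inr U) \<noteq> {}" using B F by (auto simp: nonempty_opens_def)
      ultimately show ?thesis using F by blast
    qed
    then show ?thesis unfolding dense_intersects_open by blast
  qed
  ultimately show ?thesis unfolding favorable_def by blast
qed

lemma mu_is_least:
  fixes X :: "'a topology"
  assumes "topspace X \<noteq> {}"
  shows "Cinfinite (mu X)" "favorable (mu X) X"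
    "\<And>r :: (nat + 'a set) rel. Cinfinite r \<Longrightarrow> favorable r X \<Longrightarrow> mu X \<le>o r"
  using least_infinite_card[where P = "\<lambda>r. favorable r X",
      OF Cinfinite_nat_plus_set favorable_nat_plus_set[OF assms], folded mu_def]
  by auto

definition skeletal_map :: "'a topology \<Rightarrow> 'b topology \<Rightarrow> ('a \<Rightarrow> 'b) \<Rightarrow> bool" where
  "skeletal_map X Y f \<longleftrightarrow>
     continuous_map X Y f \<and> f ` topspace X = topspace Y \<and>
     (\<forall>U. openin X U \<and> U \<noteq> {} \<longrightarrow> Y interior_of (Y closure_of (f ` U)) \<noteq> {})"

text \<open>
  A directed set is a set \<open>S\<close> with a preorder \<open>r\<close>, \<open>(a, b) \<in> r\<close> meaning \<open>a \<le> b\<close>.  Antisymmetry is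
  not required, so that least upper bounds need not be unique; conditions on \<open>sup A\<close> are imposed for
  each of them.
\<close>

definition directed_set :: "'i set \<Rightarrow> 'i rel \<Rightarrow> bool" where
  "directed_set S r \<longleftrightarrow>
     preorder_on S r \<and> S \<noteq> {} \<and> (\<forall>a\<in>S. \<forall>b\<in>S. \<exists>c\<in>S. (a, c) \<in> r \<and> (b, c) \<in> r)"

definition is_lub :: "'i set \<Rightarrow> 'i rel \<Rightarrow> 'i set \<Rightarrow> 'i \<Rightarrow> bool" where
  "is_lub S r A c \<longleftrightarrow>
     c \<in> S \<and> (\<forall>a\<in>A. (a, c) \<in> r) \<and> (\<forall>d\<in>S. (\<forall>a\<in>A. (a, d) \<in> r) \<longrightarrow> (c, d) \<in> r)"

text \<open>Chains are non-empty, so no least element of \<open>S\<close> is required.\<close>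

definition small_chain :: "'k rel \<Rightarrow> 'i set \<Rightarrow> 'i rel \<Rightarrow> 'i set \<Rightarrow> bool" where
  "small_chain \<kappa> S r A \<longleftrightarrow> A \<subseteq> S \<and> A \<noteq> {} \<and> A \<in> Chains r \<and> |A| \<le>o \<kappa>"

definition complete_directed_set :: "'k rel \<Rightarrow> 'i set \<Rightarrow> 'i rel \<Rightarrow> bool" where
  "complete_directed_set \<kappa> S r \<longleftrightarrow>
     directed_set S r \<and> (\<forall>A. small_chain \<kappa> S r A \<longrightarrow> (\<exists>c. is_lub S r A c))"

text \<open>The bonding map from \<open>X b\<close> onto \<open>X a\<close>, for \<open>a \<le> b\<close>, is \<open>p b a\<close>.\<close>

definition inverse_system ::
  "'i set \<Rightarrow> 'i rel \<Rightarrow> ('i \<Rightarrow> 'b topology) \<Rightarrow> ('i \<Rightarrow> 'i \<Rightarrow> 'b \<Rightarrow> 'b) \<Rightarrow> bool" where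
  "inverse_system S r X p \<longleftrightarrow>
     directed_set S r \<and>
     (\<forall>a\<in>S. topspace (X a) \<noteq> {}) \<and>
     (\<forall>(a, b)\<in>r. continuous_map (X b) (X a) (p b a) \<and> p b a ` topspace (X b) = topspace (X a)) \<and>
     (\<forall>a\<in>S. \<forall>x\<in>topspace (X a). p a a x = x) \<and>
     (\<forall>a b c. (a, b) \<in> r \<and> (b, c) \<in> r \<longrightarrow> (\<forall>x\<in>topspace (X c). p b a (p c b x) = p c a x))"

definition inverse_limit ::
  "'i set \<Rightarrow> 'i rel \<Rightarrow> ('i \<Rightarrow> 'b topology) \<Rightarrow> ('i \<Rightarrow> 'i \<Rightarrow> 'b \<Rightarrow> 'b) \<Rightarrow> ('i \<Rightarrow> 'b) topology" where
  "inverse_limit A r X p =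
     subtopology (product_topology X A)
       {x. \<forall>a\<in>A. \<forall>b\<in>A. (a, b) \<in> r \<longrightarrow> p b a (x b) = x a}"

text \<open>
  That \<open>X c\<close> is the limit of the restriction of the system to \<open>A\<close> means that the canonical map
  induced by the bonding maps \<open>p c a\<close> is a homeomorphism.
\<close>

definition complete_inverse_system ::
  "'k rel \<Rightarrow> 'i set \<Rightarrow> 'i rel \<Rightarrow> ('i \<Rightarrow> 'b topology) \<Rightarrow> ('i \<Rightarrow> 'i \<Rightarrow> 'b \<Rightarrow> 'b) \<Rightarrow> bool" where
  "complete_inverse_system \<kappa> S r X p \<longleftrightarrow>
     inverse_system S r X p \<and> complete_directed_set \<kappa> S r \<and>
     (\<forall>A c. small_chain \<kappa> S r A \<and> is_lub S r A c \<longrightarrow>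
        homeomorphic_map (X c) (inverse_limit A r X p) (\<lambda>x. \<lambda>a\<in>A. p c a x))"

text \<open>
  The assumption that the maps of the system are onto includes the limit projections, as usual for
  inverse systems of this kind.  This does not follow from surjectivity of the bonding maps: an
  inverse limit of a countably complete system of second countable spaces with open surjective
  bonding maps may even be empty, e.g. the system of all injections from \<open>A\<close> to \<open>E\<close> (as subspaces of
  the powers of \<open>E\<close>), where \<open>A\<close> ranges over the countable subsets of \<open>\<omega>\<^sub>2\<close> and \<open>E\<close> is a set of
  \<open>\<omega>\<^sub>1\<close> reals whose non-empty relatively open subsets are uncountable.
\<close>

definition projections_onto ::
  "'i set \<Rightarrow> 'i rel \<Rightarrow> ('i \<Rightarrow> 'b topology) \<Rightarrow> ('i \<Rightarrow> 'i \<Rightarrow> 'b \<Rightarrow> 'b) \<Rightarrow> bool" where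
  "projections_onto S r X p \<longleftrightarrow>
     (\<forall>a\<in>S. (\<lambda>x. x a) ` topspace (inverse_limit S r X p) = topspace (X a))"

text \<open>
  Membership of \<open>Y\<close> in the class, by means of a system indexed by elements of \<open>'i\<close> whose spaces have
  points in \<open>'b\<close>.  HOL cannot quantify over types inside a formula; the two type arguments make
  statements about the class range over all choices of \<open>'i\<close> and \<open>'b\<close>.
\<close>

definition class_C :: "'i itself \<Rightarrow> 'b itself \<Rightarrow> 'k rel \<Rightarrow> 'a topology \<Rightarrow> bool" where
  "class_C TI TB \<kappa> Y \<longleftrightarrow>
     topspace Y \<noteq> {} \<and>
     (\<exists>(S :: 'i set) r (X :: 'i \<Rightarrow> 'b topology) p.
        complete_inverse_system \<kappa> S r X p \<and>
        projections_onto S r X p \<and>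
        (\<forall>a\<in>S. t0_space (X a) \<and> weight (X a) \<le>o \<kappa>) \<and>
        (\<forall>(a, b)\<in>r. skeletal_map (X b) (X a) (p b a)) \<and>
        Y homeomorphic_space inverse_limit S r X p)"

end

theory Submission
  imports Defs
begin

text \<open>
  The strategy builds, along the play, an increasing sequence of indices \<open>\<tau> \<alpha>\<close> such that the
  \<open>\<alpha>\<close>-th move \<open>B \<alpha>\<close> contains the preimage of a non-empty open subset of the space at \<open>\<tau> \<alpha>\<close>, and
  by bookkeeping it plays at some later stage the preimage of each basic open set of each of these
  spaces.  Let \<open>c\<close> be the supremum of the sequence.  A non-empty open set of the limit contains the
  preimage of an open set at some index above \<open>c\<close>, whose image in the space at \<open>c\<close> is somewhere
  dense, because the bonding map is skeletal.  By continuity of the system at \<open>c\<close>, this image is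
  dense in the preimage of a basic open set of the space at some \<open>\<tau> \<gamma>\<close>.  That set was played, and
  the answer to it meets the given open set.
\<close>

section \<open>Well-orders and cardinals\<close>

lemma underS_eq_imp_eq:
  assumes "Well_order r" "a \<in> Field r" "b \<in> Field r" "underS r a = underS r b"
  shows "a = b"
proof (rule ccontr)
  assume "a \<noteq> b"
  moreover from this have "(a, b) \<in> r \<or> (b, a) \<in> r"
    using assms(1-3) by (auto simp: order_on_defs total_on_def)
  ultimately show False using assms(4) by (auto simp: underS_def)
qed

lemma underS_trans:
  assumes "Well_order r" "a \<in> underS r b" "b \<in> underS r c"
  shows "a \<in> underS r c"
  using assms unfolding underS_def order_on_defs
  by (auto dest: antisymD transD)

text \<open>Read \<open>h \<alpha> = (\<gamma>, \<delta>)\<close> as the task scheduled for stage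
  \<open>\<alpha>\<close>: treat basic set \<open>\<delta>\<close> of the space chosen at stage
  \<open>\<gamma>\<close>, which is known because \<open>\<gamma>\<close> comes earlier. Since
  \<open>\<kappa>\<close> absorbs products, every pair can be scheduled \<open>\<kappa>\<close> many
  times, and fewer than \<open>\<kappa>\<close> stages are at or before
  \<open>\<gamma>\<close>.\<close>

lemma Cinfinite_bookkeeping:
  assumes "Cinfinite \<kappa>"
  obtains h where
    "\<And>\<gamma> \<delta>. \<gamma> \<in> Field \<kappa> \<Longrightarrow> \<delta> \<in> Field \<kappa> \<Longrightarrow> \<exists>\<alpha>\<in>Field \<kappa>. \<gamma> \<in> underS \<kappa> \<alpha> \<and> h \<alpha> = (\<gamma>, \<delta>)"
proof -
  let ?F = "Field \<kappa>"
  have C: "Card_order \<kappa>" and inf: "infinite ?F" using assms by (auto simp: cinfinite_def)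
  have W: "Well_order \<kappa>" using C card_order_on_well_order_on by blast
  have "|?F \<times> ?F| =o |?F|" using inf by (rule card_of_Times_same_infinite)
  then have "|(?F \<times> ?F) \<times> ?F| =o |?F|"
    using inf card_of_Times_infinite[of ?F "?F \<times> ?F"] ordIso_iff_ordLeq by force
  then obtain g where g: "bij_betw g ?F ((?F \<times> ?F) \<times> ?F)"
    using card_of_ordIso ordIso_symmetric by blast
  show ?thesis
  proof (rule that[of "fst \<circ> g"])
    fix \<gamma> \<delta> assume \<gamma>: "\<gamma> \<in> ?F" and \<delta>: "\<delta> \<in> ?F"
    show "\<exists>\<alpha>\<in>?F. \<gamma> \<in> underS \<kappa> \<alpha> \<and> (fst \<circ> g) \<alpha> = (\<gamma>, \<delta>)"
    proof (rule ccontr)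
      assume no: "\<not> ?thesis"
      let ?T = "{\<alpha>\<in>?F. fst (g \<alpha>) = (\<gamma>, \<delta>)}"
      \<comment> \<open>A strict upper bound \<open>b\<close> of \<open>\<gamma>\<close> turns "at
        or before \<open>\<gamma>\<close>" into an initial segment, whose size is less than
        \<open>\<kappa>\<close>.\<close>
      obtain b where b: "b \<in> ?F" "\<gamma> \<in> underS \<kappa> b"
        using infinite_Card_order_limit[OF C inf \<gamma>] by (auto simp: underS_def)
      have "\<alpha> \<in> underS \<kappa> b" if "\<alpha> \<in> ?T" for \<alpha>
      proof -
        have "\<alpha> = \<gamma> \<or> \<alpha> \<in> underS \<kappa> \<gamma>"
          using that no \<gamma> W by (auto simp: order_on_defs total_on_def underS_def)
        then show ?thesis using b underS_trans[OF W] by blast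
      qed
      then have "|?T| \<le>o |underS \<kappa> b|" by (intro card_of_mono1) blast
      \<comment> \<open>The last coordinate of \<open>g\<close> is free, so the occurrences of one
        pair map onto the whole field.\<close>
      moreover have "?F \<subseteq> (snd \<circ> g) ` ?T"
      proof
        fix x assume "x \<in> ?F"
        then have "((\<gamma>, \<delta>), x) \<in> g ` ?F" using g \<gamma> \<delta> by (simp add: bij_betw_def)
        then obtain \<alpha> where "\<alpha> \<in> ?F" "g \<alpha> = ((\<gamma>, \<delta>), x)" by auto
        then show "x \<in> (snd \<circ> g) ` ?T" by (intro image_eqI[of _ _ \<alpha>]) auto
      qed
      then have "|?F| \<le>o |?T|" by (rule surj_imp_ordLeq)
      moreover have "|underS \<kappa> b| <o |?F|"
        using card_of_underS[OF C b(1)] card_of_Field_ordIso[OF C]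
        by (meson ordIso_symmetric ordLess_ordIso_trans)
      ultimately show False
        by (meson not_ordLess_ordLeq ordLeq_transitive)
    qed
  qed
qed

section \<open>Bases of inverse limits\<close>

text \<open>A basic box restricts finitely many coordinates. An index above all of them exists by
  directedness, and the restrictions pull back along the bonding maps to a single open set there.
  This serves both the full index set and chains in it.\<close>

lemma inverse_limit_cylinder:
  assumes A: "A \<noteq> {}" "\<And>a b. a \<in> A \<Longrightarrow> b \<in> A \<Longrightarrow> \<exists>c\<in>A. (a, c) \<in> r \<and> (b, c) \<in> r"
    and "trans r"
    and cont: "\<And>a b. a \<in> A \<Longrightarrow> b \<in> A \<Longrightarrow> (a, b) \<in> r \<Longrightarrow> continuous_map (X b) (X a) (p b a)"
    and V: "openin (inverse_limit A r X p) V" "x \<in> V"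
  obtains c W where "c \<in> A" "openin (X c) W" "x c \<in> W"
    "{y \<in> topspace (inverse_limit A r X p). y c \<in> W} \<subseteq> V"
proof -
  let ?L = "{x. \<forall>a\<in>A. \<forall>b\<in>A. (a, b) \<in> r \<longrightarrow> p b a (x b) = x a}"
  obtain T where T: "openin (product_topology X A) T" "V = T \<inter> ?L"
    using V(1) by (auto simp: inverse_limit_def openin_subtopology)
  then obtain U where U: "finite {i \<in> A. U i \<noteq> topspace (X i)}" "\<And>i. i \<in> A \<Longrightarrow> openin (X i) (U i)"
    "x \<in> Pi\<^sub>E A U" "Pi\<^sub>E A U \<subseteq> T"
    using V(2) by (auto simp: openin_product_topology_alt)
  have bound: "\<exists>c\<in>A. \<forall>a\<in>F. (a, c) \<in> r" if "finite F" "F \<subseteq> A" for F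
    using that
  proof (induction F)
    case empty
    then show ?case using A(1) by blast
  next
    case (insert a F)
    then obtain c where c: "c \<in> A" "\<forall>a\<in>F. (a, c) \<in> r" by auto
    moreover obtain d where d: "d \<in> A" "(a, d) \<in> r" "(c, d) \<in> r"
      using A(2)[of a c] insert.prems c(1) by auto
    ultimately have "\<forall>b\<in>insert a F. (b, d) \<in> r" using transD[OF \<open>trans r\<close>] by blast
    then show ?case using d(1) by blast
  qed
  let ?F = "{i \<in> A. U i \<noteq> topspace (X i)}"
  obtain c where c: "c \<in> A" "\<And>a. a \<in> ?F \<Longrightarrow> (a, c) \<in> r" using bound[of ?F] U(1) by blast
  \<comment> \<open>The factor \<open>topspace (X c)\<close> covers the case of no restricted
    coordinate, where the intersection is the whole type.\<close>
  define W where "W = topspace (X c) \<inter> (\<Inter>a\<in>?F. {z \<in> topspace (X c). p c a z \<in> U a})"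
  have "openin (X c) W"
  proof (cases "?F = {}")
    case True
    then show ?thesis unfolding W_def True by simp
  next
    case False
    have "openin (X c) (\<Inter>a\<in>?F. {z \<in> topspace (X c). p c a z \<in> U a})"
      using U(1,2) c cont False
      by (intro openin_INT2 openin_continuous_map_preimage) auto
    then show ?thesis by (simp add: W_def openin_Int)
  qed
  moreover have "x c \<in> W"
  proof -
    have "p c a (x c) = x a" if "a \<in> ?F" for a using V(2) T(2) c that by auto
    moreover have "x a \<in> U a" if "a \<in> A" for a using U(3) that by auto
    moreover have "x c \<in> topspace (X c)"
      using U(2)[OF c(1)] calculation(2)[OF c(1)] openin_subset by blast
    ultimately show ?thesis by (auto simp: W_def)
  qed
  moreover have "y \<in> V" if y: "y \<in> topspace (inverse_limit A r X p)" "y c \<in> W" for y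
  proof -
    have yL: "y \<in> ?L" and y': "y \<in> Pi\<^sub>E A (\<lambda>i. topspace (X i))"
      using y(1) by (auto simp: inverse_limit_def topspace_subtopology)
    have "y a \<in> U a" if "a \<in> A" for a
    proof (cases "a \<in> ?F")
      case True
      then have "p c a (y c) = y a" using yL c that by auto
      moreover have "p c a (y c) \<in> U a" using y(2) True by (auto simp: W_def)
      ultimately show ?thesis by simp
    next
      case False
      then show ?thesis using y' that by auto
    qed
    then have "y \<in> Pi\<^sub>E A U" using y' by (auto simp: PiE_iff)
    then show ?thesis using U(4) T(2) yL by blast
  qed
  ultimately show ?thesis using that c(1) by blast
qed

section \<open>The winning strategy\<close>

text \<open>The limit is replaced by a space \<open>X\<close> with compatible projections
  \<open>q\<close> onto the factors and a base of one-index cylinders. A homeomorphism onto the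
  limit can thus be absorbed into \<open>q\<close>.\<close>

locale skeletal_representation =
  fixes \<kappa> :: "'k rel" and S :: "'i set" and r :: "'i rel" and Z :: "'i \<Rightarrow> 'b topology"
    and p :: "'i \<Rightarrow> 'i \<Rightarrow> 'b \<Rightarrow> 'b" and X :: "'a topology" and q :: "'i \<Rightarrow> 'a \<Rightarrow> 'b"
  assumes \<kappa>: "Cinfinite \<kappa>"
    and complete: "complete_inverse_system \<kappa> S r Z p"
    and weight_le: "a \<in> S \<Longrightarrow> weight (Z a) \<le>o \<kappa>"
    and skeletal: "(a, b) \<in> r \<Longrightarrow> skeletal_map (Z b) (Z a) (p b a)"
    and proj_continuous: "a \<in> S \<Longrightarrow> continuous_map X (Z a) (q a)"
    and proj_onto: "a \<in> S \<Longrightarrow> q a ` topspace X = topspace (Z a)"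
    and proj_compatible: "(a, b) \<in> r \<Longrightarrow> x \<in> topspace X \<Longrightarrow> p b a (q b x) = q a x"
    and cylinder_base: "openin X V \<Longrightarrow> x \<in> V \<Longrightarrow>
      \<exists>a\<in>S. \<exists>W. openin (Z a) W \<and> q a x \<in> W \<and> {y \<in> topspace X. q a y \<in> W} \<subseteq> V"
begin

section \<open>Cylinders over the projections\<close>

definition cyl :: "'i \<Rightarrow> 'b set \<Rightarrow> 'a set" where
  "cyl a W = {y \<in> topspace X. q a y \<in> W}"

lemma well: "Well_order \<kappa>"
  using \<kappa> card_order_on_well_order_on by blast

lemma wf: "wf (\<kappa> - Id)"
  using well by (simp add: well_order_on_def)

lemma system: "inverse_system S r Z p"
  using complete by (simp add: complete_inverse_system_def)

lemma directed: "directed_set S r"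
  using system by (simp add: inverse_system_def)

lemma index_preorder: "r \<subseteq> S \<times> S" "a \<in> S \<Longrightarrow> (a, a) \<in> r" "trans r"
  using directed by (auto simp: directed_set_def preorder_on_def refl_on_def)

lemma index_trans: "(a, b) \<in> r \<Longrightarrow> (b, c) \<in> r \<Longrightarrow> (a, c) \<in> r"
  using index_preorder(3) by (rule transD)

lemma bonding_continuous: "(a, b) \<in> r \<Longrightarrow> continuous_map (Z b) (Z a) (p b a)"
  using system by (auto simp: inverse_system_def)

lemma bonding_onto: "(a, b) \<in> r \<Longrightarrow> p b a ` topspace (Z b) = topspace (Z a)"
  using system unfolding inverse_system_def by fast

lemma cyl_nonempty_open:
  assumes "a \<in> S" "openin (Z a) W" "W \<noteq> {}"
  shows "cyl a W \<in> nonempty_opens X"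
proof -
  have "openin X (cyl a W)"
    unfolding cyl_def using proj_continuous assms openin_continuous_map_preimage by blast
  moreover obtain w where "w \<in> W" "w \<in> q a ` topspace X"
    using assms(3) proj_onto[OF assms(1)] openin_subset[OF assms(2)] by auto
  ultimately show ?thesis by (auto simp: nonempty_opens_def cyl_def)
qed

lemma topspace_nonempty_open: "topspace X \<in> nonempty_opens X"
proof -
  obtain a where "a \<in> S" using directed by (auto simp: directed_set_def)
  moreover from this have "topspace (Z a) \<noteq> {}" using system by (auto simp: inverse_system_def)
  ultimately have "topspace X \<noteq> {}" using proj_onto by blast
  then show ?thesis by (simp add: nonempty_opens_def)
qed

text \<open>A cylinder inside \<open>V\<close> with index \<open>b\<close> is also a cylinder at any
  common upper bound of \<open>a\<close> and \<open>b\<close>.\<close>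

lemma cylinder_above:
  assumes "V \<in> nonempty_opens X" "a \<in> S"
  obtains c W where "c \<in> S" "(a, c) \<in> r" "openin (Z c) W" "W \<noteq> {}" "cyl c W \<subseteq> V"
proof -
  obtain x where x: "openin X V" "x \<in> V" using assms(1) by (auto simp: nonempty_opens_def)
  then have xX: "x \<in> topspace X" using openin_subset by blast
  obtain b W where b: "b \<in> S" "openin (Z b) W" "q b x \<in> W" "cyl b W \<subseteq> V"
    using cylinder_base[OF x] unfolding cyl_def by blast
  obtain c where c: "c \<in> S" "(a, c) \<in> r" "(b, c) \<in> r"
    using directed assms(2) b(1) by (auto simp: directed_set_def)
  let ?W = "{z \<in> topspace (Z c). p c b z \<in> W}"
  have "openin (Z c) ?W"
    using bonding_continuous[OF c(3)] b(2) openin_continuous_map_preimage by blast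
  moreover have "q c x \<in> ?W"
    using proj_onto[OF c(1)] xX b(3) proj_compatible[OF c(3) xX] by auto
  moreover have "cyl c ?W \<subseteq> cyl b W"
    using proj_compatible[OF c(3)] by (auto simp: cyl_def)
  ultimately show ?thesis using that c b(4) by blast
qed

section \<open>Indices chosen by transfinite recursion along a play\<close>

definition next_index :: "'i set \<Rightarrow> 'a set \<Rightarrow> 'i" where
  "next_index A V = (SOME c. c \<in> S \<and> (\<forall>a\<in>A. (a, c) \<in> r) \<and>
     (\<exists>W. openin (Z c) W \<and> W \<noteq> {} \<and> cyl c W \<subseteq> V))"

lemma next_index:
  assumes "A = {} \<or> small_chain \<kappa> S r A" "V \<in> nonempty_opens X"
  shows "next_index A V \<in> S" "\<And>a. a \<in> A \<Longrightarrow> (a, next_index A V) \<in> r"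
    "\<exists>W. openin (Z (next_index A V)) W \<and> W \<noteq> {} \<and> cyl (next_index A V) W \<subseteq> V"
proof -
  \<comment> \<open>A small chain is bounded by its supremum; for empty \<open>A\<close> any element
    of \<open>S\<close> serves.\<close>
  have "\<exists>d\<in>S. \<forall>a\<in>A. (a, d) \<in> r"
    using assms(1) complete directed
    unfolding complete_inverse_system_def complete_directed_set_def is_lub_def directed_set_def
    by blast
  then obtain d where d: "d \<in> S" "\<forall>a\<in>A. (a, d) \<in> r" by blast
  obtain c W where "c \<in> S" "(d, c) \<in> r" "openin (Z c) W" "W \<noteq> {}" "cyl c W \<subseteq> V"
    using cylinder_above[OF assms(2) d(1)] by blast
  then have "\<exists>c. c \<in> S \<and> (\<forall>a\<in>A. (a, c) \<in> r) \<and>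
      (\<exists>W. openin (Z c) W \<and> W \<noteq> {} \<and> cyl c W \<subseteq> V)"
    using d index_trans by blast
  from someI_ex[OF this] show "next_index A V \<in> S" "\<And>a. a \<in> A \<Longrightarrow> (a, next_index A V) \<in> r"
    "\<exists>W. openin (Z (next_index A V)) W \<and> W \<noteq> {} \<and> cyl (next_index A V) W \<subseteq> V"
    unfolding next_index_def by auto
qed

text \<open>The value at \<open>\<alpha>\<close> depends on the moves before \<open>\<alpha>\<close>
  and on the move at \<open>\<alpha>\<close> itself.\<close>

definition index_sequence :: "('k \<Rightarrow> 'a set) \<Rightarrow> 'k \<Rightarrow> 'i" where
  "index_sequence B = wfrec (\<kappa> - Id) (\<lambda>t \<alpha>. next_index (t ` underS \<kappa> \<alpha>) (B \<alpha>))"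

lemma index_sequence_unfold:
  "index_sequence B \<alpha> = next_index (index_sequence B ` underS \<kappa> \<alpha>) (B \<alpha>)"
proof -
  let ?F = "\<lambda>t \<alpha>. next_index (t ` underS \<kappa> \<alpha>) (B \<alpha>)"
  have "cut f (\<kappa> - Id) \<alpha> ` underS \<kappa> \<alpha> = f ` underS \<kappa> \<alpha>" for f :: "'k \<Rightarrow> 'i"
    by (intro image_cong) (auto simp: cut_def underS_def)
  then show ?thesis
    unfolding index_sequence_def by (subst wfrec[OF wf]) simp
qed

text \<open>The strategy sees only an initial part of the play; this lemma shows that the indices it
  computes from there are those of the full play.\<close>

lemma index_sequence_cong:
  assumes "B \<alpha> = B' \<alpha>" "\<And>\<beta>. \<beta> \<in> underS \<kappa> \<alpha> \<Longrightarrow> B \<beta> = B' \<beta>"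
  shows "index_sequence B \<alpha> = index_sequence B' \<alpha>"
  using assms
proof (induction \<alpha> rule: wf_induct_rule[OF wf])
  case (1 \<alpha>)
  have "index_sequence B \<beta> = index_sequence B' \<beta>" if "\<beta> \<in> underS \<kappa> \<alpha>" for \<beta>
  proof (rule 1(1))
    show "(\<beta>, \<alpha>) \<in> \<kappa> - Id" using that by (auto simp: underS_def)
    show "B \<beta> = B' \<beta>" using 1(3) that .
    show "B \<gamma> = B' \<gamma>" if "\<gamma> \<in> underS \<kappa> \<beta>" for \<gamma>
      using 1(3) underS_trans[OF well that \<open>\<beta> \<in> underS \<kappa> \<alpha>\<close>] .
  qed
  then have "index_sequence B ` underS \<kappa> \<alpha> = index_sequence B' ` underS \<kappa> \<alpha>"
    by (rule image_cong[OF refl])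
  then show ?case
    using 1(2) by (metis index_sequence_unfold)
qed

text \<open>The set \<open>D\<close> is an initial segment during the inductive construction and all
  of \<open>Field \<kappa>\<close> once it is complete.\<close>

lemma index_sequence_chain:
  assumes "D \<subseteq> Field \<kappa>" "D \<noteq> {}" "\<And>\<alpha>. \<alpha> \<in> D \<Longrightarrow> index_sequence B \<alpha> \<in> S"
    and "\<And>\<alpha> \<beta>. \<alpha> \<in> D \<Longrightarrow> \<beta> \<in> underS \<kappa> \<alpha> \<Longrightarrow> (index_sequence B \<beta>, index_sequence B \<alpha>) \<in> r"
  shows "small_chain \<kappa> S r (index_sequence B ` D)"
proof -
  have "|D| \<le>o |Field \<kappa>|" using assms(1) by (rule card_of_mono1)
  then have "|index_sequence B ` D| \<le>o \<kappa>"
    using card_of_image[of "index_sequence B" D] \<kappa> card_of_Field_ordIso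
    by (metis ordLeq_ordIso_trans ordLeq_transitive)
  moreover have "(index_sequence B a, index_sequence B b) \<in> r \<or>
      (index_sequence B b, index_sequence B a) \<in> r" if ab: "a \<in> D" "b \<in> D" for a b
  proof -
    have "a = b \<or> a \<in> underS \<kappa> b \<or> b \<in> underS \<kappa> a"
      using well ab assms(1) by (auto simp: order_on_defs total_on_def underS_def)
    then show ?thesis using assms(3,4) ab index_preorder(2) by blast
  qed
  ultimately show ?thesis
    using assms(2,3) by (auto simp: small_chain_def Chains_def)
qed

text \<open>By induction the earlier indices form a small chain, so
  \<open>\<kappa>\<close>-completeness bounds them and \<open>next_index\<close> behaves as
  intended.\<close>

lemma index_sequence_step:
  assumes B: "\<And>\<beta>. B \<beta> \<in> nonempty_opens X"
  shows "index_sequence B \<alpha> \<in> S \<and>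
    (\<forall>\<beta>\<in>underS \<kappa> \<alpha>. (index_sequence B \<beta>, index_sequence B \<alpha>) \<in> r)"
    (is "?P \<alpha>")
    and index_sequence_witness: "\<exists>W. openin (Z (index_sequence B \<alpha>)) W \<and> W \<noteq> {} \<and>
      cyl (index_sequence B \<alpha>) W \<subseteq> B \<alpha>"
proof -
  have chain: "index_sequence B ` underS \<kappa> \<alpha> = {} \<or> small_chain \<kappa> S r (index_sequence B ` underS \<kappa> \<alpha>)"
    if "\<And>\<beta>. \<beta> \<in> underS \<kappa> \<alpha> \<Longrightarrow> ?P \<beta>" for \<alpha>
  proof (cases "underS \<kappa> \<alpha> = {}")
    case False
    moreover have "underS \<kappa> \<alpha> \<subseteq> Field \<kappa>" by (auto simp: underS_def Field_def)
    ultimately show ?thesis using index_sequence_chain that by blast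
  qed simp
  have P: "?P \<alpha>" for \<alpha>
  proof (induction \<alpha> rule: wf_induct_rule[OF wf])
    case (1 \<alpha>)
    then have "?P \<beta>" if "\<beta> \<in> underS \<kappa> \<alpha>" for \<beta> using that by (auto simp: underS_def)
    from next_index(1,2)[OF chain[OF this] B[of \<alpha>]] show ?case
      unfolding index_sequence_unfold[of B \<alpha>] by blast
  qed
  show "?P \<alpha>" by (rule P)
  show "\<exists>W. openin (Z (index_sequence B \<alpha>)) W \<and> W \<noteq> {} \<and> cyl (index_sequence B \<alpha>) W \<subseteq> B \<alpha>"
    using next_index(3)[OF chain[OF P] B[of \<alpha>]] unfolding index_sequence_unfold[of B \<alpha>] .
qed

lemma enumerated_bases:
  obtains e where "\<And>a. a \<in> S \<Longrightarrow> is_base (Z a) (e a ` Field \<kappa>)"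
proof -
  have "\<exists>f. is_base (Z a) (f ` Field \<kappa>)" if "a \<in> S" for a
  proof -
    obtain \<B> where \<B>: "is_base (Z a) \<B>" "|\<B>| \<le>o weight (Z a)" using weight_is_least(2) by blast
    \<comment> \<open>Needed to turn the size bound into a surjection from
      \<open>Field \<kappa>\<close>. The enumeration may repeat sets and may contain the empty
      set.\<close>
    have "\<B> \<noteq> {}"
      using \<B>(1) system that unfolding is_base_def inverse_system_def
      by (metis all_not_in_conv openin_topspace)
    moreover have "|\<B>| \<le>o |Field \<kappa>|"
      using \<B>(2) weight_le[OF that] \<kappa> card_of_Field_ordIso
      by (meson ordIso_symmetric ordLeq_ordIso_trans ordLeq_transitive)
    ultimately show ?thesis using \<B>(1) card_of_ordLeq2 by metis
  qed
  then show ?thesis using that by metis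
qed

text \<open>At the supremum \<open>c\<close> of \<open>A\<close>, skeletality makes the trace of
  \<open>V\<close> dense in a non-empty open set, and continuity of the system puts the preimage of
  some \<open>W\<close> from an index in \<open>A\<close> inside that set. A cylinder below
  \<open>cyl a W\<close> with index in \<open>A\<close> has an open trace at \<open>c\<close>, so it
  cannot avoid \<open>V\<close>.\<close>

lemma meets_cylinder:
  assumes A: "small_chain \<kappa> S r A" and V: "V \<in> nonempty_opens X"
  obtains a W where "a \<in> A" "openin (Z a) W" "W \<noteq> {}"
    "\<And>b W'. b \<in> A \<Longrightarrow> openin (Z b) W' \<Longrightarrow> W' \<noteq> {} \<Longrightarrow> cyl b W' \<subseteq> cyl a W \<Longrightarrow> cyl b W' \<inter> V \<noteq> {}"
proof -
  obtain c where c: "is_lub S r A c"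
    using A complete by (auto simp: complete_inverse_system_def complete_directed_set_def)
  have hom: "homeomorphic_map (Z c) (inverse_limit A r Z p) (\<lambda>x. \<lambda>a\<in>A. p c a x)"
    (is "homeomorphic_map _ ?L ?\<phi>")
    using A c complete by (auto simp: complete_inverse_system_def)
  have cS: "c \<in> S" and Ac: "\<And>a. a \<in> A \<Longrightarrow> (a, c) \<in> r" using c by (auto simp: is_lub_def)
  obtain d V' where d: "d \<in> S" "(c, d) \<in> r" "openin (Z d) V'" "V' \<noteq> {}" "cyl d V' \<subseteq> V"
    using cylinder_above[OF V cS] by blast
  let ?G = "Z c interior_of (Z c closure_of (p d c ` V'))"
  obtain z where z: "z \<in> ?G"
    using skeletal[OF d(2)] d(3,4) unfolding skeletal_map_def by blast
  have G: "openin (Z c) ?G" by simp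
  have A': "A \<noteq> {}" "A \<subseteq> S" "\<And>a b. a \<in> A \<Longrightarrow> b \<in> A \<Longrightarrow> (a, b) \<in> r \<or> (b, a) \<in> r"
    using A by (auto simp: small_chain_def Chains_def)
  \<comment> \<open>As \<open>Z c\<close> is the limit over \<open>A\<close>, the open set
    \<open>?G\<close> corresponds to an open set of that limit and contains a cylinder with index in
    \<open>A\<close>.\<close>
  obtain a W where a: "a \<in> A" "openin (Z a) W" "?\<phi> z a \<in> W" "{y \<in> topspace ?L. y a \<in> W} \<subseteq> ?\<phi> ` ?G"
  proof (rule inverse_limit_cylinder[of A r Z p "?\<phi> ` ?G" "?\<phi> z"])
    show "\<exists>c\<in>A. (a, c) \<in> r \<and> (b, c) \<in> r" if "a \<in> A" "b \<in> A" for a b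
      using A' that index_preorder(2) by blast
    show "openin ?L (?\<phi> ` ?G)"
      using hom G homeomorphic_imp_open_map open_map_def by blast
  qed (use A' index_preorder(3) bonding_continuous z in auto)
  show ?thesis
  proof (rule that[of a W])
    show "W \<noteq> {}" using a(3) by blast
    fix b W' assume b: "b \<in> A" "openin (Z b) W'" "W' \<noteq> {}" "cyl b W' \<subseteq> cyl a W"
    let ?H = "{z \<in> topspace (Z c). p c b z \<in> W'}"
    have H: "openin (Z c) ?H"
      using bonding_continuous[OF Ac[OF b(1)]] b(2) openin_continuous_map_preimage by blast
    obtain y where y: "y \<in> ?H"
    proof -
      obtain w where "w \<in> W'" using b(3) by blast
      moreover from this have "w \<in> p c b ` topspace (Z c)"
        using bonding_onto[OF Ac[OF b(1)]] openin_subset[OF b(2)] by auto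
      ultimately show ?thesis using that by auto
    qed
    \<comment> \<open>The inclusion of cylinders holds in \<open>X\<close>, so \<open>y\<close> is
      lifted along the surjection \<open>q c\<close> to use it.\<close>
    have "y \<in> ?G"
    proof -
      obtain x where x: "x \<in> topspace X" "y = q c x" using y proj_onto[OF cS] by blast
      then have "x \<in> cyl b W'" using y proj_compatible[OF Ac[OF b(1)] x(1)] by (auto simp: cyl_def)
      then have "p c a y \<in> W"
        using b(4) x proj_compatible[OF Ac[OF a(1)] x(1)] by (auto simp: cyl_def)
      moreover have "?\<phi> y \<in> topspace ?L"
        using y homeomorphic_imp_surjective_map[OF hom] by blast
      ultimately have "?\<phi> y \<in> ?\<phi> ` ?G" using a(1,4) by auto
      then show ?thesis
        using homeomorphic_imp_injective_map[OF hom] y openin_subset[OF G]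
        by (metis (no_types, lifting) inj_on_image_mem_iff mem_Collect_eq)
    qed
    then have "y \<in> Z c closure_of (p d c ` V')" by (rule subsetD[OF interior_of_subset])
    \<comment> \<open>\<open>?H\<close> is an open neighbourhood of a point in the closure of the
      image of \<open>V'\<close>. A common point of the two, lifted to \<open>X\<close> through
      \<open>q d\<close>, lies in both \<open>V\<close> and \<open>cyl b W'\<close>.\<close>
    then have "\<exists>w. w \<in> p d c ` V' \<and> w \<in> ?H"
      unfolding in_closure_of using H y by (elim conjE allE[of _ ?H] impE) simp_all
    then obtain v where v: "v \<in> V'" "p d c v \<in> ?H" by blast
    obtain x where x: "x \<in> topspace X" "v = q d x"
      using v(1) proj_onto[OF d(1)] openin_subset[OF d(3)] by blast
    have "x \<in> V" using d(5) v(1) x by (auto simp: cyl_def)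
    moreover have "x \<in> cyl b W'"
      using v(2) x proj_compatible[OF d(2) x(1)] proj_compatible[OF Ac[OF b(1)] x(1)]
      by (auto simp: cyl_def)
    ultimately show "cyl b W' \<inter> V \<noteq> {}" by blast
  qed (use a in auto)
qed

lemma favorable: "favorable \<kappa> X"
proof -
  obtain h where h:
    "\<And>\<gamma> \<delta>. \<gamma> \<in> Field \<kappa> \<Longrightarrow> \<delta> \<in> Field \<kappa> \<Longrightarrow> \<exists>\<alpha>\<in>Field \<kappa>. \<gamma> \<in> underS \<kappa> \<alpha> \<and> h \<alpha> = (\<gamma>, \<delta>)"
    using Cinfinite_bookkeeping[OF \<kappa>] by blast
  obtain e where e: "\<And>a. a \<in> S \<Longrightarrow> is_base (Z a) (e a ` Field \<kappa>)"
    using enumerated_bases by blast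
  \<comment> \<open>The stage is recovered from the history, since distinct stages have distinct
    sets of predecessors.\<close>
  define idx where "idx f = (THE \<alpha>. \<alpha> \<in> Field \<kappa> \<and> underS \<kappa> \<alpha> = dom f)" for f :: "'k \<rightharpoonup> 'a set"
  \<comment> \<open>Undefined entries become the whole space, so that the recursion always receives
    non-empty open sets.\<close>
  define ext where "ext f \<beta> = (case f \<beta> of Some V \<Rightarrow> V | None \<Rightarrow> topspace X)"
    for f :: "'k \<rightharpoonup> 'a set" and \<beta>
  \<comment> \<open>The strategy plays the scheduled cylinder; the whole space is the default when
    the enumerated basic set is empty or \<open>\<delta>\<close> lies outside the field.\<close>
  define s where "s f = (case h (idx f) of (\<gamma>, \<delta>) \<Rightarrow>
      let \<tau> = index_sequence (ext f) \<gamma>; W = e \<tau> \<delta>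
      in if \<delta> \<in> Field \<kappa> \<and> W \<noteq> {} then cyl \<tau> W else topspace X)" for f
  have base_open: "openin (Z a) (e a \<delta>)" if "a \<in> S" "\<delta> \<in> Field \<kappa>" for a \<delta>
    using e[OF that(1)] that(2) by (auto simp: is_base_def)
  have s: "s \<in> (\<Union>\<alpha>\<in>Field \<kappa>. open_sequences \<kappa> X \<alpha>) \<rightarrow> nonempty_opens X"
  proof
    fix f assume "f \<in> (\<Union>\<alpha>\<in>Field \<kappa>. open_sequences \<kappa> X \<alpha>)"
    then have "ext f \<beta> \<in> nonempty_opens X" for \<beta>
      using topspace_nonempty_open
      by (auto simp: ext_def open_sequences_def ran_def split: option.split)
    then have "index_sequence (ext f) \<gamma> \<in> S" for \<gamma> using index_sequence_step by blast
    then show "s f \<in> nonempty_opens X"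
      using cyl_nonempty_open base_open topspace_nonempty_open
      by (simp add: s_def Let_def split: prod.split)
  qed
  have "X closure_of (\<Union>\<alpha>\<in>Field \<kappa>. B \<alpha>) = topspace X"
    if B: "B \<in> Field \<kappa> \<rightarrow> nonempty_opens X"
      and Bs: "\<forall>\<alpha>\<in>Field \<kappa>. B \<alpha> \<subseteq> s ((Some \<circ> B) |` underS \<kappa> \<alpha>)" for B
  proof -
    define C where "C \<beta> = (if \<beta> \<in> Field \<kappa> then B \<beta> else topspace X)" for \<beta>
    have C: "C \<beta> \<in> nonempty_opens X" for \<beta>
      using B topspace_nonempty_open by (auto simp: C_def)
    define \<tau> where "\<tau> = index_sequence C"
    have \<tau>S: "\<tau> \<alpha> \<in> S" for \<alpha> using index_sequence_step[of C, OF C] by (simp add: \<tau>_def)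
    have chain: "small_chain \<kappa> S r (\<tau> ` Field \<kappa>)"
      unfolding \<tau>_def using index_sequence_step[of C, OF C] \<kappa>
      by (intro index_sequence_chain) (auto simp: cinfinite_def)
    have played: "B \<alpha> \<subseteq> cyl (\<tau> \<gamma>) (e (\<tau> \<gamma>) \<delta>)"
      if \<alpha>: "\<alpha> \<in> Field \<kappa>" "\<gamma> \<in> underS \<kappa> \<alpha>" "h \<alpha> = (\<gamma>, \<delta>)"
        and \<delta>: "\<delta> \<in> Field \<kappa>" "e (\<tau> \<gamma>) \<delta> \<noteq> {}" for \<alpha> \<gamma> \<delta>
    proof -
      let ?f = "(Some \<circ> B) |` underS \<kappa> \<alpha>"
      have "dom ?f = underS \<kappa> \<alpha>" by (auto simp: restrict_map_def dom_def)
      then have "idx ?f = \<alpha>"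
        unfolding idx_def using \<alpha>(1) underS_eq_imp_eq[OF well] by (intro the_equality) auto
      have agree: "ext ?f \<beta> = C \<beta>" if "\<beta> \<in> underS \<kappa> \<alpha>" for \<beta>
      proof -
        have "\<beta> \<in> Field \<kappa>" using that by (auto simp: underS_def Field_def)
        then show ?thesis using that by (simp add: ext_def C_def)
      qed
      \<comment> \<open>The index at \<open>\<gamma>\<close> also uses the move at
        \<open>\<gamma>\<close>, which is in the history because \<open>\<gamma>\<close> is strictly
        below \<open>\<alpha>\<close>.\<close>
      have "index_sequence (ext ?f) \<gamma> = \<tau> \<gamma>"
        unfolding \<tau>_def using agree \<alpha>(2) underS_trans[OF well _ \<alpha>(2)]
        by (intro index_sequence_cong) auto
      then have "s ?f = cyl (\<tau> \<gamma>) (e (\<tau> \<gamma>) \<delta>)"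
        using \<open>idx ?f = \<alpha>\<close> \<alpha>(3) \<delta> by (simp add: s_def Let_def)
      then show ?thesis using Bs \<alpha>(1) by metis
    qed
    have "V \<inter> (\<Union>\<alpha>\<in>Field \<kappa>. B \<alpha>) \<noteq> {}" if V: "openin X V" "V \<noteq> {}" for V
    proof -
      have "V \<in> nonempty_opens X" using V by (simp add: nonempty_opens_def)
      then obtain a W where a: "a \<in> \<tau> ` Field \<kappa>" "openin (Z a) W" "W \<noteq> {}" and meets:
        "\<And>b W'. b \<in> \<tau> ` Field \<kappa> \<Longrightarrow> openin (Z b) W' \<Longrightarrow> W' \<noteq> {} \<Longrightarrow> cyl b W' \<subseteq> cyl a W \<Longrightarrow>
          cyl b W' \<inter> V \<noteq> {}"
        using meets_cylinder[OF chain] by metis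
      obtain \<gamma> where \<gamma>: "\<gamma> \<in> Field \<kappa>" "a = \<tau> \<gamma>" using a(1) by blast
      obtain \<delta> where \<delta>: "\<delta> \<in> Field \<kappa>" "e a \<delta> \<noteq> {}" "e a \<delta> \<subseteq> W"
        using e[of a] a(2,3) \<tau>S \<gamma>(2) unfolding is_base_def by blast
      obtain \<alpha> where \<alpha>: "\<alpha> \<in> Field \<kappa>" "\<gamma> \<in> underS \<kappa> \<alpha>" "h \<alpha> = (\<gamma>, \<delta>)"
        using h[OF \<gamma>(1) \<delta>(1)] by blast
      have sub: "B \<alpha> \<subseteq> cyl a W" using played[OF \<alpha> \<delta>(1)] \<delta>(2,3) \<gamma>(2) by (auto simp: cyl_def)
      \<comment> \<open>The property \<open>meets\<close> concerns cylinders with index in the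
        chain, so it is applied to one inside the answer \<open>B \<alpha>\<close>.\<close>
      obtain W' where W': "openin (Z (\<tau> \<alpha>)) W'" "W' \<noteq> {}" "cyl (\<tau> \<alpha>) W' \<subseteq> B \<alpha>"
        using index_sequence_witness[of C \<alpha>, OF C] \<alpha>(1) by (auto simp: \<tau>_def C_def)
      have "cyl (\<tau> \<alpha>) W' \<inter> V \<noteq> {}"
        using meets[of "\<tau> \<alpha>" W'] W' sub \<alpha>(1) by blast
      then show ?thesis using W'(3) \<alpha>(1) by blast
    qed
    then show ?thesis unfolding dense_intersects_open by blast
  qed
  with s show ?thesis unfolding favorable_def by blast
qed

end

section \<open>From the class to the cardinal invariant\<close>

lemma class_C_imp_favorable:
  assumes \<kappa>: "Cinfinite \<kappa>" and "class_C TYPE('i) TYPE('b) \<kappa> X"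
  shows "favorable \<kappa> X"
proof -
  obtain S :: "'i set" and r and Z :: "'i \<Rightarrow> 'b topology" and p where
    sys: "complete_inverse_system \<kappa> S r Z p" and onto: "projections_onto S r Z p"
    and wt: "\<And>a. a \<in> S \<Longrightarrow> weight (Z a) \<le>o \<kappa>"
    and sk: "\<And>a b. (a, b) \<in> r \<Longrightarrow> skeletal_map (Z b) (Z a) (p b a)"
    and "X homeomorphic_space inverse_limit S r Z p"
    using assms(2) unfolding class_C_def by fast
  let ?L = "inverse_limit S r Z p"
  obtain f where f: "homeomorphic_map X ?L f"
    using \<open>X homeomorphic_space ?L\<close> homeomorphic_space by blast
  have dir: "directed_set S r"
    using sys by (simp add: complete_inverse_system_def inverse_system_def)
  then have r: "r \<subseteq> S \<times> S" "trans r" by (auto simp: directed_set_def preorder_on_def)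
  have img: "f ` topspace X = topspace ?L" using f by (rule homeomorphic_imp_surjective_map)
  have "skeletal_representation \<kappa> S r Z p X (\<lambda>a x. f x a)"
  \<comment> \<open>The projections are the coordinates of the homeomorphism \<open>f\<close>; they
    are onto by \<open>projections_onto\<close>.\<close>
  proof
    fix a assume "a \<in> S"
    have "continuous_map ?L (Z a) (\<lambda>x. x a)"
      unfolding inverse_limit_def
      using \<open>a \<in> S\<close> by (intro continuous_map_from_subtopology continuous_map_product_projection)
    then show "continuous_map X (Z a) (\<lambda>x. f x a)"
      using continuous_map_compose[OF homeomorphic_imp_continuous_map[OF f]] by (simp add: o_def)
    show "(\<lambda>x. f x a) ` topspace X = topspace (Z a)"
      using onto \<open>a \<in> S\<close> unfolding projections_onto_def img[symmetric] by (simp add: image_image)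
  next
    fix a b x assume "(a, b) \<in> r" "x \<in> topspace X"
    moreover from this have "f x \<in> topspace ?L" using img by blast
    ultimately show "p b a (f x b) = f x a"
      using r(1) by (auto simp: inverse_limit_def topspace_subtopology)
  next
    fix V x assume V: "openin X V" "x \<in> V"
    have "openin ?L (f ` V)" using f V(1) homeomorphic_imp_open_map open_map_def by blast
    then obtain c W where c: "c \<in> S" "openin (Z c) W" "f x c \<in> W"
      "{y \<in> topspace ?L. y c \<in> W} \<subseteq> f ` V"
    proof (rule inverse_limit_cylinder[rotated 4])
      show "continuous_map (Z b) (Z a) (p b a)" if "(a, b) \<in> r" for a b
        using sys that by (auto simp: complete_inverse_system_def inverse_system_def)
    qed (use dir r V in \<open>auto simp: directed_set_def\<close>)
    have "y \<in> V" if y: "y \<in> topspace X" "f y c \<in> W" for y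
    proof -
      have "f y \<in> f ` V" using c(4) img y by blast
      then show ?thesis
        using homeomorphic_imp_injective_map[OF f] openin_subset[OF V(1)] y(1)
        by (metis inj_on_image_mem_iff)
    qed
    then show "\<exists>a\<in>S. \<exists>W. openin (Z a) W \<and> f x a \<in> W \<and> {y \<in> topspace X. f y a \<in> W} \<subseteq> V"
      using c by blast
  qed (use \<kappa> sys wt sk in auto)
  then show ?thesis by (rule skeletal_representation.favorable)
qed

text \<open>The cardinal enters only as an upper bound for sizes of chains and for weights, and such
  bounds are invariant under isomorphism.\<close>

lemma class_C_ordIso:
  assumes "(\<kappa>, \<kappa>') \<in> ordIso" "class_C TI TB \<kappa> X"
  shows "class_C TI TB \<kappa>' X"
proof -
  have le: "R \<le>o \<kappa> \<longleftrightarrow> R \<le>o \<kappa>'" for R :: "'z rel"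
    using ordLeq_ordIso_trans[OF _ assms(1)] ordLeq_ordIso_trans[OF _ ordIso_symmetric[OF assms(1)]]
    by iprover
  have chain: "small_chain \<kappa> = small_chain \<kappa>'"
    by (intro ext) (simp only: small_chain_def le)
  have sys: "complete_inverse_system \<kappa> = complete_inverse_system \<kappa>'"
    by (intro ext) (simp only: complete_inverse_system_def complete_directed_set_def chain)
  show ?thesis using assms(2) unfolding class_C_def le sys .
qed

theorem mainTheorem4:
  fixes \<kappa> :: "'k rel" and X :: "'a topology"
  assumes "Cinfinite \<kappa>"
    and "class_C TYPE('i) TYPE('b) \<kappa> X"
  shows "mu X \<le>o \<kappa>"
proof -
  let ?U = "|UNIV :: (nat + 'a set) set|"
  have ne: "topspace X \<noteq> {}" using assms(2) by (simp add: class_C_def)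
  have W: "Well_order \<kappa>" using assms(1) card_order_on_well_order_on by blast
  \<comment> \<open>\<open>mu X\<close> is minimal among cardinals on the type
    \<open>nat + 'a set\<close>. If \<open>\<kappa>\<close> is at least the largest of these,
    \<open>?U\<close> itself gives the bound; otherwise \<open>\<kappa>\<close> has a copy on that
    type.\<close>
  consider "?U \<le>o \<kappa>" | "\<kappa> \<le>o ?U" using W card_of_Well_order ordLeq_total by blast
  then show ?thesis
  proof cases
    case 1
    have "mu X \<le>o ?U"
      using mu_is_least(3)[OF ne] favorable_nat_plus_set[OF ne] Cinfinite_nat_plus_set by blast
    then show ?thesis using 1 ordLeq_transitive by blast
  next
    case 2
    then obtain \<kappa>' :: "(nat + 'a set) rel" where iso: "(\<kappa>, \<kappa>') \<in> ordIso" using internalize_ordLeq by metis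
    have inf: "Cinfinite \<kappa>'" using iso assms(1) Cinfinite_cong by blast
    have "favorable \<kappa>' X"
      using class_C_imp_favorable[OF inf] class_C_ordIso[OF iso assms(2)] by blast
    then have "mu X \<le>o \<kappa>'" using mu_is_least(3)[OF ne] inf by blast
    then show ?thesis using iso ordIso_symmetric ordLeq_ordIso_trans by blast
  qed
qed

end
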